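(* Let $H$ be a subgroup of a non-abelian generalized group $G$ and let $A=H\times G$. For $(h_1,g_1),(h_2,g_2)\in A$, define $$(h_1,g_1)\circ(h_2,g_2)=(h_1h_2,\;h_2g_1h_2^{-1}g_2).$$ Then $(A,\circ)$ is a Bol groupoid.
   Context: A generalized group is a non-empty set $G$ with a binary operation (written multiplicatively) such that: (i) $(xy)z=x(yz)$ for all $x,y,z\in G$; (ii) for each $x\in G$ there exists a unique element $e(x)\in G$ such that $xe(x)=e(x)x=x$; (iii) for each $x\in G$ there exists $x^{-1}\in G$ such that $xx^{-1}=x^{-1}x=e(x)$. In a generalized group, the element $x^{-1}$ in (iii) is unique for each $x$. $G$ is non-abelian if $xy\neq yx$ for some $x,y\in G$. A subgroup $H$ of $G$ is a non-empty subset that is a group under the operation of $G$. A groupoid is a non-empty set $L$ with a binary operation $\cdot$ such that $x\cdot y\in L$ for all $x,y\in L$. A Bol groupoid is a groupoid satisfying the Bol identity $((xy)z)y=x((yz)y)$ for all $x,y,z$. *)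

theory Defs
  imports "HOL-Algebra.Group"
begin

locale groupoid =
  fixes L :: "'a set" and mul :: "'a \<Rightarrow> 'a \<Rightarrow> 'a" (infixl "\<cdot>" 70)
  assumes nonempty: "L \<noteq> {}"
    and closed: "\<lbrakk>x \<in> L; y \<in> L\<rbrakk> \<Longrightarrow> x \<cdot> y \<in> L"

locale bol_groupoid = groupoid +
  assumes bol: "\<lbrakk>x \<in> L; y \<in> L; z \<in> L\<rbrakk> \<Longrightarrow> ((x \<cdot> y) \<cdot> z) \<cdot> y = x \<cdot> ((y \<cdot> z) \<cdot> y)"

text \<open>The local identity \<open>e(x)\<close> and the inverse of \<open>x\<close> are meaningful for \<open>x \<in> G\<close> when \<open>G\<close> is
  a generalized group, where both exist and are unique.\<close>

definition local_id :: "'a set \<Rightarrow> ('a \<Rightarrow> 'a \<Rightarrow> 'a) \<Rightarrow> 'a \<Rightarrow> 'a" where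
  "local_id G mul x = (THE e. e \<in> G \<and> mul x e = x \<and> mul e x = x)"

definition gg_inv :: "'a set \<Rightarrow> ('a \<Rightarrow> 'a \<Rightarrow> 'a) \<Rightarrow> 'a \<Rightarrow> 'a" where
  "gg_inv G mul x = (THE y. y \<in> G \<and> mul x y = local_id G mul x \<and> mul y x = local_id G mul x)"

locale generalized_group = groupoid G mul
  for G :: "'a set" and mul :: "'a \<Rightarrow> 'a \<Rightarrow> 'a" (infixl "\<cdot>" 70) +
  assumes assoc: "\<lbrakk>x \<in> G; y \<in> G; z \<in> G\<rbrakk> \<Longrightarrow> (x \<cdot> y) \<cdot> z = x \<cdot> (y \<cdot> z)"
    and local_id_unique: "x \<in> G \<Longrightarrow> \<exists>!e. e \<in> G \<and> x \<cdot> e = x \<and> e \<cdot> x = x"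
    and inverse_exists:
      "x \<in> G \<Longrightarrow> \<exists>y\<in>G. x \<cdot> y = local_id G mul x \<and> y \<cdot> x = local_id G mul x"

definition non_abelian :: "'a set \<Rightarrow> ('a \<Rightarrow> 'a \<Rightarrow> 'a) \<Rightarrow> bool" where
  "non_abelian G mul \<longleftrightarrow> (\<exists>x\<in>G. \<exists>y\<in>G. mul x y \<noteq> mul y x)"

text \<open>A generalized group has no distinguished identity, so the identity of a subgroup is some
  element \<open>u\<close> of it; non-emptiness is part of the predicate \<open>group\<close>.\<close>

definition gg_subgroup :: "'a set \<Rightarrow> 'a set \<Rightarrow> ('a \<Rightarrow> 'a \<Rightarrow> 'a) \<Rightarrow> bool" where
  "gg_subgroup H G mul \<longleftrightarrow> H \<subseteq> G \<and> (\<exists>u. group \<lparr>carrier = H, mult = mul, one = u\<rparr>)"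

end

theory Submission
  imports Defs
begin

text \<open>On elements of \<open>H\<close> the inverse of the generalized group agrees with the group inverse of \<open>H\<close>.
  In the second component, the two sides of the Bol identity then differ only by the rewriting
  \<open>(b c b)\<^sup>-\<^sup>1 b c = b\<^sup>-\<^sup>1\<close> inside \<open>H\<close>.\<close>

context generalized_group
begin

lemma local_id_eqI:
  assumes "x \<in> G" "e \<in> G" "x \<cdot> e = x" "e \<cdot> x = x"
  shows "local_id G (\<cdot>) x = e"
  unfolding local_id_def
  by (rule the1_equality[OF local_id_unique[OF assms(1)]]) (use assms in blast)

text \<open>Distinct elements of \<open>G\<close> may have distinct local identities. Sharing that
  of \<open>x\<close> is what lets any inverse of \<open>x\<close> absorb the product
  \<open>x \<cdot> y\<close> in the uniqueness argument for inverses.\<close>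

lemma local_id_inverse:
  assumes G: "x \<in> G" "y \<in> G"
    and xy: "x \<cdot> y = local_id G (\<cdot>) x" and yx: "y \<cdot> x = local_id G (\<cdot>) x"
  shows "local_id G (\<cdot>) y = local_id G (\<cdot>) x"
proof -
  let ?u = "local_id G (\<cdot>) x"
  obtain e where e: "e \<in> G" "y \<cdot> e = y" "e \<cdot> y = y"
    using local_id_unique[OF G(2)] by blast
  obtain d where d: "d \<in> G" "x \<cdot> d = x" "d \<cdot> x = x"
    using local_id_unique[OF G(1)] by blast
  have u: "?u \<in> G" "?u \<cdot> x = x"
    using local_id_eqI[OF G(1) d] d by auto
  \<comment> \<open>Writing the second factor as \<open>x \<cdot> y\<close> lets the first be
    absorbed into \<open>x\<close>.\<close>
  have "?u \<cdot> ?u = ?u"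
    using assoc[OF u(1) G] xy u(2) by simp
  \<comment> \<open>Both \<open>e(y)\<close> and \<open>e(x)\<close> are local identities of the idempotent \<open>e(x)\<close>.\<close>
  moreover have "?u \<cdot> e = ?u"
    using assoc[OF G e(1)] xy e by simp
  moreover have "e \<cdot> ?u = ?u"
    using assoc[OF e(1) G(2,1)] yx e by simp
  ultimately have "e = ?u"
    using local_id_unique[OF u(1)] u(1) e(1) by blast
  then show ?thesis
    using local_id_eqI[OF G(2) e] by simp
qed

text \<open>Uniqueness is the usual computation
  \<open>z = z \<cdot> (x \<cdot> y) = (z \<cdot> x) \<cdot> y = y\<close>. Its outer equalities
  need \<open>z\<close> and \<open>y\<close> to have the local identity of \<open>x\<close>.\<close>

lemma gg_inv_eqI:
  assumes G: "x \<in> G" "y \<in> G"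
    and xy: "x \<cdot> y = local_id G (\<cdot>) x" and yx: "y \<cdot> x = local_id G (\<cdot>) x"
  shows "gg_inv G (\<cdot>) x = y"
  unfolding gg_inv_def
proof (rule the_equality)
  have id_laws: "w \<cdot> local_id G (\<cdot>) w = w" "local_id G (\<cdot>) w \<cdot> w = w" if "w \<in> G" for w
    using local_id_unique[OF that] local_id_eqI[OF that] by metis+
  fix z assume z: "z \<in> G \<and> x \<cdot> z = local_id G (\<cdot>) x \<and> z \<cdot> x = local_id G (\<cdot>) x"
  have "z = z \<cdot> (x \<cdot> y)"
    using id_laws[of z] local_id_inverse[of x z] G xy z by simp
  also have "\<dots> = (z \<cdot> x) \<cdot> y"
    using assoc[of z x y] G z by metis
  also have "\<dots> = y"
    using id_laws[of y] local_id_inverse[OF G xy yx] G z by simp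
  finally show "z = y" .
qed (use assms in simp)

text \<open>The identity \<open>u\<close> of the subgroup fixes \<open>h\<close> from both sides and
  lies in \<open>G\<close>, so by uniqueness it is the local identity of \<open>h\<close>. The group
  inverse of \<open>h\<close> then meets the conditions that characterize
  \<open>gg_inv\<close>.\<close>

lemma gg_inv_subgroup:
  assumes "H \<subseteq> G" and "group \<lparr>carrier = H, mult = (\<cdot>), one = u\<rparr>" and "h \<in> H"
  shows "gg_inv G (\<cdot>) h = inv\<^bsub>\<lparr>carrier = H, mult = (\<cdot>), one = u\<rparr>\<^esub> h"
proof -
  interpret K: group "\<lparr>carrier = H, mult = (\<cdot>), one = u\<rparr>" by fact
  have "local_id G (\<cdot>) h = u"
    by (rule local_id_eqI) (use assms K.one_closed K.l_one[of h] K.r_one[of h] in auto)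
  then show ?thesis
    by (intro gg_inv_eqI)
      (use assms K.inv_closed[of h] K.l_inv[of h] K.r_inv[of h] in auto)
qed

end

theorem theorem3p9:
  fixes G H :: "'a set" and mul :: "'a \<Rightarrow> 'a \<Rightarrow> 'a" (infixl "\<cdot>" 70)
  assumes "generalized_group G mul"
    and "non_abelian G mul"
    and "gg_subgroup H G mul"
  shows "bol_groupoid (H \<times> G)
    (\<lambda>(h1, g1) (h2, g2). (h1 \<cdot> h2, h2 \<cdot> g1 \<cdot> gg_inv G mul h2 \<cdot> g2))"
proof -
  interpret generalized_group G mul by fact
  obtain u where HG: "H \<subseteq> G" and grp: "group \<lparr>carrier = H, mult = mul, one = u\<rparr>"
    using assms(3) unfolding gg_subgroup_def by blast
  define K where "K = \<lparr>carrier = H, mult = mul, one = u\<rparr>"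
  interpret K: group K using grp by (simp add: K_def)
  have K_simps: "carrier K = H" "mult K = mul" by (simp_all add: K_def)
  note inv_eq = gg_inv_subgroup[OF HG grp, folded K_def]
  note H_closed = K.m_closed[unfolded K_simps] K.inv_closed[unfolded K_simps]
  have in_G: "h \<in> G" if "h \<in> H" for h using that HG by blast
  have cancel: "gg_inv G mul (a \<cdot> b \<cdot> a) \<cdot> (a \<cdot> b) = gg_inv G mul a"
    if "a \<in> H" "b \<in> H" for a b
  proof -
    \<comment> \<open>Splitting the product as \<open>(a \<cdot> b) \<cdot> a\<close> keeps
      \<open>a \<cdot> b\<close> whole, ready to cancel against the factor on its right.\<close>
    have "gg_inv G mul (a \<cdot> b \<cdot> a) = gg_inv G mul a \<cdot> gg_inv G mul (a \<cdot> b)"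
      using K.inv_mult_group[of "a \<cdot> b" a] that H_closed by (simp add: inv_eq K_simps)
    then show ?thesis
      using K.m_assoc[of "inv\<^bsub>K\<^esub> a" "inv\<^bsub>K\<^esub> (a \<cdot> b)" "a \<cdot> b"] K.l_inv[of "a \<cdot> b"]
        K.r_one[of "inv\<^bsub>K\<^esub> a"] that H_closed
      by (simp add: inv_eq K_simps)
  qed
  have inv_H: "gg_inv G mul h \<in> H" if "h \<in> H" for h
    using that H_closed by (simp add: inv_eq)
  show ?thesis
  proof (unfold_locales, goal_cases)
    case 1
    show ?case using K.one_closed nonempty by (auto simp: K_simps)
  next
    case (2 x y)
    then show ?case using H_closed(1) inv_H in_G closed by auto
  next
    case (3 x y z)
    obtain a p b q c r where xyz: "x = (a, p)" "y = (b, q)" "z = (c, r)"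
      by (metis surj_pair)
    with 3 have H: "a \<in> H" "b \<in> H" "c \<in> H" and G: "p \<in> G" "q \<in> G" "r \<in> G" by auto
    let ?b' = "gg_inv G mul b" and ?c' = "gg_inv G mul c" and ?d' = "gg_inv G mul (b \<cdot> c \<cdot> b)"
    have mem: "a \<in> G" "b \<in> G" "c \<in> G" "?b' \<in> G" "?c' \<in> G" "?d' \<in> G"
      using H inv_H in_G H_closed(1) by auto
    \<comment> \<open>This is \<open>cancel\<close> in right-nested form, the shape that rewriting
      with \<open>assoc\<close> produces. It is used with \<open>w\<close> the product of
      \<open>q\<close>, \<open>?c'\<close>, \<open>r\<close>, \<open>?b'\<close>, \<open>q\<close>,
      the common tail of both second components.\<close>
    have "?d' \<cdot> (b \<cdot> (c \<cdot> w)) = ?b' \<cdot> w" if "w \<in> G" for w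
      using cancel[OF H(2,3)] assoc[of ?d' "b \<cdot> c" w] assoc[of b c w] mem that closed by simp
    then show ?case
      using mem G by (simp add: xyz assoc closed)
  qed
qed

end
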